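(* Fix $k\ge1$ and $x>0$. For $M\ge k$ let $i^*$ be the index of the device with the $k$-th largest harvested energy among $E_1,\dots,E_M$ (energy-based selection, EBS) and let $\Pi^{(k)}_{\rm EBS}(x)=\mathbb P\{X_{i^*}\le x\}$ be its outage probability. Put $r=\frac{\sigma_n^2ct_2x}{t_1(ac-b)}$ and $$A_M(x)=1-\frac{1}{\Gamma(k)}\exp(-r)\sum_{n=0}^\infty\frac{(-1)^nM^{n+k}}{n!}\sqrt{\frac{4rc}{P_t(n+k)}}\;K_1\left(\sqrt{\frac{4rc(n+k)}{P_t}}\right).$$ Then $A_M(x)$ is the asymptotic outage probability of the EBS scheme as the number of devices grows: $$\lim_{M\to\infty}\left(\Pi^{(k)}_{\rm EBS}(x)-A_M(x)\right)=0.$$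
   Context: There are $M$ devices. The channel gains $|g_i|^2,|h_i|^2$ ($i\ge1$) are independent exponential random variables with mean $1$. Parameters (independent of $M$): $P_t>0$, $\sigma_n^2>0$, $0<t_1<1$, $t_2=1-t_1$, and real constants $a,b,c$ with $c>0$ and $ac-b>0$. The energy harvested by device $i$ is $E_i=t_1\left(\frac{aP_t|g_i|^2+b}{P_t|g_i|^2+c}-\frac bc\right)$, and the SNR of device $i$ is $X_i=\frac{|h_i|^2}{t_2\sigma_n^2}E_i$. The outage probability at rate threshold $Q>0$ is $\mathbb P\{t_2\log_2(1+X)\le Q\}=\mathbb P\{X\le x\}$ with $x=2^{Q/t_2}-1$. $\Gamma$ is the gamma function and $K_1$ is the modified Bessel function of the second kind of order one. *)

theory Defs
  imports "HOL-Probability.Probability"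
begin

(* The modified Bessel function of the second kind of real order nu, by its integral
   representation on the positive half-line; only meaningful for z > 0. *)
definition bessel_K :: "real \<Rightarrow> real \<Rightarrow> real" where
  "bessel_K \<nu> z = (LINT t:{0..}|lborel. exp (- z * cosh t) * cosh (\<nu> * t))"

definition harvested_energy :: "real \<Rightarrow> real \<Rightarrow> real \<Rightarrow> real \<Rightarrow> real \<Rightarrow> real \<Rightarrow> real" where
  "harvested_energy t1 Pt a b c G = t1 * ((a * Pt * G + b) / (Pt * G + c) - b / c)"

definition snr :: "real \<Rightarrow> real \<Rightarrow> real \<Rightarrow> real \<Rightarrow> real" where
  "snr t2 \<sigma>2 H e = H / (t2 * \<sigma>2) * e"

(* Devices 1, ..., M listed by decreasing value of e (ties, a null event here, are broken in
   favour of the smaller index since sort_key is stable). Only meaningful for 1 <= k <= M. *)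
definition kth_largest_index :: "nat \<Rightarrow> nat \<Rightarrow> (nat \<Rightarrow> real) \<Rightarrow> nat" where
  "kth_largest_index k M e = sort_key (\<lambda>i. - e i) [1..<Suc M] ! (k - 1)"

(* g and h are the channel coefficients; \<sigma>2 is the noise variance. *)
definition ebs_outage ::
  "'w measure \<Rightarrow> (nat \<Rightarrow> 'w \<Rightarrow> complex) \<Rightarrow> (nat \<Rightarrow> 'w \<Rightarrow> complex) \<Rightarrow>
   real \<Rightarrow> real \<Rightarrow> real \<Rightarrow> real \<Rightarrow> real \<Rightarrow> real \<Rightarrow> real \<Rightarrow> nat \<Rightarrow> nat \<Rightarrow> real \<Rightarrow> real" where
  "ebs_outage \<Omega> g h Pt \<sigma>2 t1 t2 a b c k M x =
     measure \<Omega> {\<omega> \<in> space \<Omega>.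
       let E = (\<lambda>i. harvested_energy t1 Pt a b c ((cmod (g i \<omega>))\<^sup>2));
           X = (\<lambda>i. snr t2 \<sigma>2 ((cmod (h i \<omega>))\<^sup>2) (E i))
       in X (kth_largest_index k M E) \<le> x}"

definition ebs_outage_asymp :: "real \<Rightarrow> real \<Rightarrow> real \<Rightarrow> nat \<Rightarrow> nat \<Rightarrow> real" where
  "ebs_outage_asymp Pt c r k M =
     1 - 1 / Gamma (real k) * exp (- r) *
       (\<Sum>n. (-1) ^ n * real M ^ (n + k) / fact n
              * sqrt (4 * r * c / (Pt * real (n + k)))
              * bessel_K 1 (sqrt (4 * r * c * real (n + k) / Pt)))"

end

theory Submission
  imports Defs
begin

text \<open>Both the outage probability and \<open>A_M\<close> converge to \<open>1 - exp (- r)\<close>.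

The selected index depends on the gains \<open>g\<close> only, so the fading gain \<open>|h|\<^sup>2\<close> of the selected
device is again exponential with mean 1. Its outage event is \<open>|h|\<^sup>2 \<le> r (1 + c / (Pt |g|\<^sup>2))\<close>, and
the \<open>k\<close>-th largest \<open>|g|\<^sup>2\<close> tends to infinity in probability.

With \<open>\<beta> = r c / Pt\<close>, each Bessel term of \<open>A_M\<close> is \<open>\<integral> exp (- \<beta> / y - (n + k) y) dy\<close> over \<open>y > 0\<close>
(substitute \<open>y = sqrt (\<beta> / (n + k)) exp s\<close>). Summing the exponential series under the integral and
shifting \<open>y = ln M - s\<close> gives
\<open>\<integral> exp (- \<beta> / (ln M - s)) exp (k s - exp s) ds\<close> over \<open>s < ln M\<close>, which tends to \<open>\<Gamma>(k)\<close> by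
dominated convergence.\<close>

section \<open>Exponential substitution and the integral behind the Bessel terms\<close>

text \<open>The map \<open>s \<mapsto> \<alpha> * exp s\<close> is a bijection from the reals onto
  the positive half-line and is its own derivative. Nonnegativity turns the gauge integral into an
  absolutely convergent one, as the change of variables demands; Borel measurability brings the
  result back from Lebesgue measure to \<open>lborel\<close>.\<close>

lemma has_bochner_integral_exp_substitution:
  fixes f :: "real \<Rightarrow> real"
  assumes I: "(f has_integral I) {0<..}" and nonneg: "\<And>y. y > 0 \<Longrightarrow> 0 \<le> f y"
    and [measurable]: "f \<in> borel_measurable borel" and "\<alpha> > 0"
  shows "has_bochner_integral lborel (\<lambda>s. \<alpha> * exp s * f (\<alpha> * exp s)) I"
proof -
  let ?h = "\<lambda>s. \<alpha> * exp s * f (\<alpha> * exp s)"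
  have image: "(\<lambda>s. \<alpha> * exp s) ` UNIV = {0<..}"
  proof safe
    fix y :: real assume "y > 0"
    then have "y = \<alpha> * exp (ln (y / \<alpha>))" using \<open>\<alpha> > 0\<close> by simp
    then show "y \<in> range (\<lambda>s. \<alpha> * exp s)" by blast
  qed (use \<open>\<alpha> > 0\<close> in simp)
  have "f absolutely_integrable_on {0<..} \<and> integral {0<..} f = I"
    using I nonneg by (auto simp: has_integral_iff intro!: nonnegative_absolutely_integrable_1)
  moreover have "((\<lambda>s. \<alpha> * exp s) has_real_derivative \<alpha> * exp s) (at s)" for s
    by (auto intro!: derivative_eq_intros)
  ultimately have *: "?h absolutely_integrable_on UNIV \<and> integral UNIV ?h = I"
    using has_absolute_integral_change_of_variables_1'
      [of UNIV "\<lambda>s. \<alpha> * exp s" "\<lambda>s. \<alpha> * exp s" f I] \<open>\<alpha> > 0\<close>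
    unfolding image by (simp add: inj_on_def abs_mult)
  then have int: "integrable lborel ?h"
    by (simp add: set_integrable_def integrable_completion)
  with * show ?thesis
    by (simp add: has_bochner_integral_iff integral_lborel)
qed

text \<open>Since \<open>\<beta> / y \<ge> 0\<close>, the integrand is dominated by
  \<open>exp (- p * y)\<close>, whose integral over the half-line is \<open>1 / p\<close>. The bound
  later controls the series of integrals.\<close>

lemma integrable_exp_minus_inverse:
  fixes \<beta> p :: real
  assumes "\<beta> \<ge> 0" "p > 0"
  shows "integrable lborel (\<lambda>y. indicator {0<..} y * exp (- \<beta> / y - p * y))"
    and "(\<integral>y. indicator {0<..} y * exp (- \<beta> / y - p * y) \<partial>lborel) \<le> 1 / p"
proof -
  have "((\<lambda>y. exp (- p * y)) has_integral exp (- p * 0) / p) {0..}"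
    using assms by (intro has_integral_exp_minus_to_infinity) auto
  then have "((\<lambda>y. exp (- p * y)) has_integral 1 / p) {0<..}"
    by (subst has_integral_spike_set_eq[of _ "{0..}"])
       (auto intro: negligible_subset[of "{0}"] empty_imp_negligible)
  then have "(\<lambda>y. exp (- p * y)) absolutely_integrable_on {0<..}"
      "integral {0<..} (\<lambda>y. exp (- p * y)) = 1 / p"
    by (auto simp: has_integral_iff intro!: nonnegative_absolutely_integrable_1)
  then have e: "has_bochner_integral lborel (\<lambda>y. indicator {0<..} y * exp (- (p * y))) (1 / p)"
    using set_lebesgue_integral_eq_integral(2)[of "{0<..}" "\<lambda>y. exp (- p * y)"]
    by (simp add: set_integrable_def set_lebesgue_integral_def integrable_completion
        integral_completion has_bochner_integral_iff)
  show "integrable lborel (\<lambda>y. indicator {0<..} y * exp (- \<beta> / y - p * y))"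
    by (rule Bochner_Integration.integrable_bound[OF integrable.intros[OF e]])
       (use assms in \<open>auto simp: indicator_def\<close>)
  then show "(\<integral>y. indicator {0<..} y * exp (- \<beta> / y - p * y) \<partial>lborel) \<le> 1 / p"
    unfolding has_bochner_integral_iff[THEN iffD1, OF e, THEN conjunct2, symmetric]
    by (intro integral_mono integrable.intros[OF e])
       (use assms in \<open>auto simp: indicator_def\<close>)
qed

lemma bessel_K_1_integral:
  fixes \<beta> p :: real
  assumes "\<beta> > 0" "p > 0"
  shows "(\<integral>y. indicator {0<..} y * exp (- \<beta> / y - p * y) \<partial>lborel)
           = sqrt (4 * \<beta> / p) * bessel_K 1 (sqrt (4 * \<beta> * p))" (is "?I = _")
proof -
  \<comment> \<open>At \<open>y = \<alpha>\<close> the terms \<open>\<beta> / y\<close> and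
    \<open>p * y\<close> coincide, so under \<open>y = \<alpha> * exp s\<close> their sum becomes
    symmetric in \<open>s\<close>, namely \<open>z * cosh s\<close>.\<close>
  define \<alpha> where "\<alpha> = sqrt (\<beta> / p)"
  define z where "z = sqrt (4 * \<beta> * p)"
  have "\<alpha> > 0" using assms by (simp add: \<alpha>_def)
  have sq: "\<alpha>\<^sup>2 = \<beta> / p" using assms by (simp add: \<alpha>_def)
  have z: "z = 2 * (\<alpha> * p)"
    unfolding z_def using assms \<open>\<alpha> > 0\<close> sq
    by (intro real_sqrt_unique) (auto simp: power_mult_distrib field_simps power2_eq_square)
  have z': "\<beta> / \<alpha> = \<alpha> * p"
    using sq assms \<open>\<alpha> > 0\<close> by (simp add: field_simps power2_eq_square)
  let ?\<phi> = "\<lambda>s. \<alpha> * exp s * exp (- z * cosh s)"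
  have "((\<lambda>y. exp (- \<beta> / y - p * y)) has_integral ?I) {0<..}"
    using has_integral_set_lebesgue[of "{0<..}" "\<lambda>y. exp (- \<beta> / y - p * y)"]
      integrable_exp_minus_inverse(1)[of \<beta> p] assms
    by (auto simp: set_integrable_def set_lebesgue_integral_def integrable_completion
        integral_completion)
  from has_bochner_integral_exp_substitution[OF this _ _ \<open>\<alpha> > 0\<close>]
  have "has_bochner_integral lborel (\<lambda>s. \<alpha> * exp s * exp (- \<beta> / (\<alpha> * exp s) - p * (\<alpha> * exp s))) ?I"
    by simp
  also have "(\<lambda>s. \<alpha> * exp s * exp (- \<beta> / (\<alpha> * exp s) - p * (\<alpha> * exp s))) = ?\<phi>"
  proof
    fix s
    have "- \<beta> / (\<alpha> * exp s) - p * (\<alpha> * exp s) = - (\<beta> / \<alpha>) * exp (- s) - (\<alpha> * p) * exp s"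
      by (simp add: exp_minus field_simps)
    also have "\<dots> = - z * cosh s"
      unfolding z' z by (simp add: cosh_def algebra_simps)
    finally show "\<alpha> * exp s * exp (- \<beta> / (\<alpha> * exp s) - p * (\<alpha> * exp s)) = ?\<phi> s" by simp
  qed
  finally have \<phi>: "integrable lborel ?\<phi>" "?I = integral\<^sup>L lborel ?\<phi>"
    by (auto simp: has_bochner_integral_iff)
  have cm[measurable]: "(cosh :: real \<Rightarrow> real) \<in> borel_measurable borel"
    by (intro borel_measurable_continuous_onI continuous_intros)
  have ir: "integrable lborel (\<lambda>s. ?\<phi> (- s))"
    using lborel_integrable_real_affine[OF \<phi>(1), of "-1" 0] by simp
  have pos: "integrable lborel (\<lambda>s. indicator {0..} s * ?\<phi> s)"
    and neg: "integrable lborel (\<lambda>s. indicator {..<0} s * ?\<phi> s)"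
    and neg': "integrable lborel (\<lambda>s. indicator {0..} s * ?\<phi> (- s))"
    using integrable_mult_indicator[OF _ \<phi>(1), of "{0..}"]
      integrable_mult_indicator[OF _ \<phi>(1), of "{..<0}"]
      integrable_mult_indicator[OF _ ir, of "{0..}"] by simp_all
  have "?I = (\<integral>s. indicator {0..} s * ?\<phi> s + indicator {..<0} s * ?\<phi> s \<partial>lborel)"
    unfolding \<phi>(2) by (intro Bochner_Integration.integral_cong) (auto simp: indicator_def)
  also have "\<dots> = (\<integral>s. indicator {0..} s * ?\<phi> s \<partial>lborel) + (\<integral>s. indicator {..<0} s * ?\<phi> s \<partial>lborel)"
    using pos neg by (rule Bochner_Integration.integral_add)
  \<comment> \<open>Reflection folds the negative half-line onto the positive one; the two
    indicators then differ only at the null point \<open>s = 0\<close>.\<close>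
  also have "(\<integral>s. indicator {..<0} s * ?\<phi> s \<partial>lborel) = (\<integral>s. indicator {..<0} (- s) * ?\<phi> (- s) \<partial>lborel)"
    using lborel_integral_real_affine[of "-1" "\<lambda>s. indicator {..<0} s * ?\<phi> s" 0] by simp
  also have "\<dots> = (\<integral>s. indicator {0..} s * ?\<phi> (- s) \<partial>lborel)"
    by (intro integral_cong_AE AE_I2[THEN AE_mp[OF AE_lborel_singleton[of 0]]])
       (auto simp: indicator_def)
  \<comment> \<open>Here \<open>exp s + exp (- s) = 2 * cosh s\<close> produces the weight in the
    definition of \<open>bessel_K 1\<close>; the factor \<open>1\<close> in
    \<open>cosh (1 * s)\<close> matches its order.\<close>
  also have "(\<integral>s. indicator {0..} s * ?\<phi> s \<partial>lborel) + \<dots>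
      = (\<integral>s. 2 * \<alpha> * (indicator {0..} s * (exp (- z * cosh s) * cosh (1 * s))) \<partial>lborel)"
    unfolding Bochner_Integration.integral_add[OF pos neg', symmetric]
    by (intro Bochner_Integration.integral_cong) (auto simp: cosh_def algebra_simps)
  also have "\<dots> = 2 * \<alpha> * bessel_K 1 z"
    by (simp add: bessel_K_def set_lebesgue_integral_def)
  also have "2 * \<alpha> = sqrt (4 * \<beta> / p)"
    using real_sqrt_mult[of 4 "\<beta> / p"] by (simp add: \<alpha>_def)
  finally show ?thesis by (simp add: z_def)
qed

section \<open>The limit of the asymptotic expression\<close>

text \<open>This is Euler's integral after \<open>t = exp s\<close>. The integrand serves below both
  as pointwise limit and as dominating function.\<close>

lemma has_bochner_integral_Gamma:
  assumes "k \<ge> (1::nat)"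
  shows "has_bochner_integral lborel (\<lambda>s. exp (real k * s - exp s)) (Gamma (real k))"
proof -
  have "((\<lambda>t. t powr (real k - 1) / exp t) has_integral Gamma (real k)) {0<..}"
    using Gamma_integral_real[of "real k"] assms
    by (subst has_integral_spike_set_eq[of _ "{0..}"])
       (auto intro: negligible_subset[of "{0}"] empty_imp_negligible)
  from has_bochner_integral_exp_substitution[OF this, of 1]
  have "has_bochner_integral lborel (\<lambda>s. exp s * (exp s powr (real k - 1) / exp (exp s))) (Gamma (real k))"
    by simp
  also have "(\<lambda>s. exp s * (exp s powr (real k - 1) / exp (exp s))) = (\<lambda>s. exp (real k * s - exp s))"
  proof
    fix s :: real
    have "exp s * (exp s powr (real k - 1) / exp (exp s)) = exp (s + (real k - 1) * s - exp s)"
      by (simp add: powr_def exp_diff exp_add)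
    then show "exp s * (exp s powr (real k - 1) / exp (exp s)) = exp (real k * s - exp s)"
      by (simp add: algebra_simps)
  qed
  finally show ?thesis .
qed

text \<open>The alternating series may be summed under the integral because it converges absolutely,
  with total mass at most \<open>m ^ k * exp m\<close>. After the shift by \<open>ln m\<close>, the
  parameter \<open>m\<close> survives only in the cutoff and in the factor tending to 1.\<close>

lemma suminf_exp_minus_inverse_integral:
  fixes \<beta> m :: real
  assumes "\<beta> > 0" "m > 0" "k \<ge> (1::nat)"
  shows "(\<Sum>n. (-1) ^ n * m ^ (n + k) / fact n *
            (\<integral>y. indicator {0<..} y * exp (- \<beta> / y - real (n + k) * y) \<partial>lborel))
         = (\<integral>s. indicator {..<ln m} s * exp (- \<beta> / (ln m - s)) * exp (real k * s - exp s) \<partial>lborel)"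
proof -
  let ?e = "\<lambda>n y. indicator {0<..} y * exp (- \<beta> / y - real (n + k) * y)"
  define f where "f n y = (-1) ^ n * m ^ (n + k) / fact n * ?e n y" for n :: nat and y :: real
  define C where "C y = indicator {0<..} y * (m ^ k * exp (- \<beta> / y - real k * y))" for y :: real
  define F where "F y = C y * exp (- m * exp (- y))" for y
  \<comment> \<open>The index \<open>n\<close> enters only through \<open>exp (- n * y)\<close>, so
    each term is a fixed function times a term of the exponential series at
    \<open>- m * exp (- y)\<close>.\<close>
  have f_eq: "f n y = C y * ((- m * exp (- y)) ^ n /\<^sub>R fact n)" for n y
  proof -
    have "exp (- \<beta> / y - real (n + k) * y) = exp (- \<beta> / y - real k * y) * exp (- y) ^ n"
      by (simp add: exp_of_nat_mult[symmetric] exp_add[symmetric] algebra_simps)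
    moreover have "(- m * exp (- y)) ^ n = (-1) ^ n * m ^ n * exp (- y) ^ n"
      by (metis mult_minus1 power_mult_distrib)
    ultimately show ?thesis
      by (simp add: f_def C_def power_add field_simps)
  qed
  have int: "integrable lborel (f n)" for n
    unfolding f_def using assms by (intro integrable_mult_right integrable_exp_minus_inverse) auto
  have norm_int: "(\<integral>y. norm (f n y) \<partial>lborel) \<le> m ^ k * (m ^ n /\<^sub>R fact n)" for n
  proof -
    have "(\<integral>y. norm (f n y) \<partial>lborel) = (\<integral>y. m ^ (n + k) / fact n * ?e n y \<partial>lborel)"
      using assms by (intro Bochner_Integration.integral_cong) (auto simp: f_def abs_mult power_abs)
    also have "\<dots> = m ^ (n + k) / fact n * (\<integral>y. ?e n y \<partial>lborel)" by simp
    also have "\<dots> \<le> m ^ (n + k) / fact n * (1 / real (n + k))"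
      using assms by (intro mult_left_mono integrable_exp_minus_inverse) auto
    \<comment> \<open>Here \<open>k \<ge> 1\<close> gives \<open>n + k \<ge> 1\<close>, also for
      \<open>n = 0\<close>.\<close>
    also have "\<dots> \<le> m ^ (n + k) / fact n * 1"
      using assms by (intro mult_left_mono) auto
    finally show ?thesis by (simp add: power_add field_simps)
  qed
  have "(\<Sum>n. integral\<^sup>L lborel (f n)) = (\<integral>y. (\<Sum>n. f n y) \<partial>lborel)"
  proof (rule integral_suminf[symmetric])
    show "AE y in lborel. summable (\<lambda>n. norm (f n y))"
      unfolding f_eq norm_mult by (intro AE_I2 summable_mult summable_norm_exp)
    show "summable (\<lambda>n. \<integral>y. norm (f n y) \<partial>lborel)"
      by (rule summable_comparison_test'[OF summable_mult[OF summable_exp_generic]])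
         (use norm_int in simp)
  qed (rule int)
  also have "(\<lambda>y. \<Sum>n. f n y) = F"
    unfolding f_eq F_def
    by (intro ext sums_unique[symmetric] sums_mult exp_converges)
  also have "integral\<^sup>L lborel F = (\<integral>s. F (ln m - s) \<partial>lborel)"
    using lborel_integral_real_affine[of "-1" F "ln m"] by simp
  also have "(\<lambda>s. F (ln m - s))
      = (\<lambda>s. indicator {..<ln m} s * exp (- \<beta> / (ln m - s)) * exp (real k * s - exp s))"
  proof
    fix s
    have "m ^ k = exp (real k * ln m)"
      using assms by (simp add: exp_of_nat_mult)
    \<comment> \<open>The growing prefactor \<open>m ^ k\<close> is cancelled exactly by the
      shift.\<close>
    then have "m ^ k * exp (- (real k * (ln m - s))) = exp (real k * s)"
      by (simp add: mult_exp_exp algebra_simps)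
    note power = this
    have "m * exp (- (ln m - s)) = exp s"
      using assms by (simp add: exp_diff)
    then have inner: "- m * exp (- (ln m - s)) = - exp s" by simp
    have split: "exp (- \<beta> / (ln m - s) - real k * (ln m - s))
        = exp (- \<beta> / (ln m - s)) * exp (- (real k * (ln m - s)))"
      "exp (real k * s - exp s) = exp (real k * s) * exp (- exp s)"
      by (simp_all add: mult_exp_exp)
    have "F (ln m - s) = indicator {..<ln m} s * exp (- \<beta> / (ln m - s))
        * (m ^ k * exp (- (real k * (ln m - s)))) * exp (- exp s)"
      unfolding F_def C_def inner split by (simp add: indicator_def)
    then show "F (ln m - s)
      = indicator {..<ln m} s * exp (- \<beta> / (ln m - s)) * exp (real k * s - exp s)"
      unfolding power split by (simp only: mult.assoc)
  qed
  finally show ?thesis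
    by (simp add: f_def)
qed

lemma ebs_outage_asymp_tendsto:
  assumes "Pt > 0" "c > 0" "r > 0" "k \<ge> 1"
  shows "ebs_outage_asymp Pt c r k \<longlonglongrightarrow> 1 - exp (- r)"
proof -
  define \<beta> where "\<beta> = r * c / Pt"
  have "\<beta> > 0" using assms by (simp add: \<beta>_def)
  let ?J = "\<lambda>M s. indicator {..<ln (real M)} s * exp (- \<beta> / (ln (real M) - s)) * exp (real k * s - exp s)"
  \<comment> \<open>The integral form involves \<open>ln M\<close> and is claimed for
    \<open>M \<ge> 1\<close>, which suffices for a limit.\<close>
  have eq: "ebs_outage_asymp Pt c r k M = 1 - 1 / Gamma (real k) * exp (- r) * (\<integral>s. ?J M s \<partial>lborel)"
    if "M \<ge> 1" for M
  proof -
    have "sqrt (4 * r * c / (Pt * real (n + k))) * bessel_K 1 (sqrt (4 * r * c * real (n + k) / Pt))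
        = (\<integral>y. indicator {0<..} y * exp (- \<beta> / y - real (n + k) * y) \<partial>lborel)" for n
      using bessel_K_1_integral[OF \<open>\<beta> > 0\<close>, of "real (n + k)"] assms
      by (simp add: \<beta>_def mult_ac)
    then show ?thesis
      using suminf_exp_minus_inverse_integral[OF \<open>\<beta> > 0\<close>, of "real M" k] that assms
      by (simp add: ebs_outage_asymp_def mult.assoc)
  qed
  have ln_top: "filterlim (\<lambda>M. ln (real M)) at_top sequentially"
    by (rule filterlim_compose[OF ln_at_top filterlim_real_sequentially])
  have "(\<lambda>M. \<integral>s. ?J M s \<partial>lborel) \<longlonglongrightarrow> (\<integral>s. exp (real k * s - exp s) \<partial>lborel)"
  proof (rule integral_dominated_convergence)
    show "integrable lborel (\<lambda>s. exp (real k * s - exp s))"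
      using has_bochner_integral_Gamma[OF \<open>k \<ge> 1\<close>] by (simp add: has_bochner_integral_iff)
    show "AE s in lborel. (\<lambda>M. ?J M s) \<longlonglongrightarrow> exp (real k * s - exp s)"
    proof (rule AE_I2)
      fix s
      \<comment> \<open>For fixed \<open>s\<close> the gap \<open>ln M - s\<close> tends to
        infinity, so the correction factor tends to 1 and the indicator is eventually 1.\<close>
      have "(\<lambda>M. - \<beta> / (ln (real M) - s)) \<longlonglongrightarrow> 0"
        using filterlim_tendsto_add_at_top[OF tendsto_const ln_top, of "- s"]
        by (intro tendsto_divide_0[OF tendsto_const] filterlim_at_top_imp_at_infinity) simp
      then have "(\<lambda>M. exp (- \<beta> / (ln (real M) - s)) * exp (real k * s - exp s))
          \<longlonglongrightarrow> exp 0 * exp (real k * s - exp s)"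
        by (intro tendsto_intros)
      then have "(\<lambda>M. exp (- \<beta> / (ln (real M) - s)) * exp (real k * s - exp s))
          \<longlonglongrightarrow> exp (real k * s - exp s)" by simp
      moreover have "\<forall>\<^sub>F M in sequentially.
          exp (- \<beta> / (ln (real M) - s)) * exp (real k * s - exp s) = ?J M s"
        using ln_top[unfolded filterlim_at_top_dense, rule_format, of s]
        by eventually_elim simp
      ultimately show "(\<lambda>M. ?J M s) \<longlonglongrightarrow> exp (real k * s - exp s)"
        by (rule Lim_transform_eventually)
    qed
    show "AE s in lborel. norm (?J M s) \<le> exp (real k * s - exp s)" for M
      using \<open>\<beta> > 0\<close> by (auto simp: indicator_def abs_mult)
  qed simp_all
  also have "(\<integral>s. exp (real k * s - exp s) \<partial>lborel) = Gamma (real k)"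
    using has_bochner_integral_Gamma[OF \<open>k \<ge> 1\<close>] by (simp add: has_bochner_integral_iff)
  finally have "(\<lambda>M. 1 - 1 / Gamma (real k) * exp (- r) * (\<integral>s. ?J M s \<partial>lborel))
      \<longlonglongrightarrow> 1 - 1 / Gamma (real k) * exp (- r) * Gamma (real k)"
    by (intro tendsto_intros)
  moreover have "Gamma (real k) > 0"
    by (rule Gamma_real_pos) (use \<open>k \<ge> 1\<close> in simp)
  then have "1 / Gamma (real k) * exp (- r) * Gamma (real k) = exp (- r)"
    by (simp add: field_simps)
  ultimately have "(\<lambda>M. 1 - 1 / Gamma (real k) * exp (- r) * (\<integral>s. ?J M s \<partial>lborel))
      \<longlonglongrightarrow> 1 - exp (- r)"
    by (simp only:)
  moreover have "\<forall>\<^sub>F M in sequentially.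
      1 - 1 / Gamma (real k) * exp (- r) * (\<integral>s. ?J M s \<partial>lborel) = ebs_outage_asymp Pt c r k M"
    by (rule eventually_mono[OF eventually_ge_at_top[of 1]]) (simp only: eq)
  ultimately show ?thesis
    by (rule Lim_transform_eventually)
qed

section \<open>Measurability and rank of the selected index\<close>

text \<open>The list is fixed and only the keys are random: each recursion step branches on a
  comparison of two measurable keys.\<close>

lemma measurable_insort_key:
  fixes f :: "'a \<Rightarrow> 'w \<Rightarrow> real"
  assumes "\<And>y. y \<in> insert x (set ys) \<Longrightarrow> f y \<in> borel_measurable N"
  shows "(\<lambda>\<omega>. insort_key (\<lambda>y. f y \<omega>) x ys) \<in> measurable N (count_space UNIV)"
  using assms
proof (induction ys)
  case (Cons y ys)
  have [measurable]: "f x \<in> borel_measurable N" "f y \<in> borel_measurable N"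
    using Cons.prems by auto
  have [measurable]: "(\<lambda>\<omega>. insort_key (\<lambda>y. f y \<omega>) x ys) \<in> measurable N (count_space UNIV)"
    by (rule Cons.IH) (use Cons.prems in auto)
  have [measurable]: "(\<lambda>\<omega>. y # insort_key (\<lambda>y. f y \<omega>) x ys) \<in> measurable N (count_space UNIV)"
    by (rule measurable_compose[of _ _ "count_space UNIV" "\<lambda>ys. y # ys"]) simp_all
  show ?case
    unfolding insort_key.simps by (intro measurable_If) measurable
qed simp

text \<open>The tail sorted so far is itself random. As \<open>'a\<close> is countable, it takes
  countably many values, and the insertion can be treated separately for each of them.\<close>

lemma measurable_sort_key:
  fixes f :: "'a::countable \<Rightarrow> 'w \<Rightarrow> real"
  assumes "\<And>y. y \<in> set xs \<Longrightarrow> f y \<in> borel_measurable N"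
  shows "(\<lambda>\<omega>. sort_key (\<lambda>y. f y \<omega>) xs) \<in> measurable N (count_space UNIV)"
  using assms
proof (induction xs)
  case (Cons x xs)
  \<comment> \<open>Lists outside \<open>?L\<close> never occur, and their keys are not known to be
    measurable.\<close>
  let ?L = "{ys. set ys \<subseteq> set xs}"
  have "(\<lambda>\<omega>. sort_key (\<lambda>y. f y \<omega>) xs) \<in> measurable N (count_space UNIV)"
    using Cons by simp
  then have "(\<lambda>\<omega>. sort_key (\<lambda>y. f y \<omega>) xs) \<in> measurable N (count_space ?L)"
    unfolding measurable_count_space_eq2_countable by (auto intro: measurable_sets)
  then have "(\<lambda>\<omega>. insort_key (\<lambda>y. f y \<omega>) x (sort_key (\<lambda>y. f y \<omega>) xs)) \<in> measurable N (count_space UNIV)"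
  proof (rule measurable_compose_countable'[rotated])
    show "(\<lambda>\<omega>. insort_key (\<lambda>y. f y \<omega>) x ys) \<in> measurable N (count_space UNIV)" if "ys \<in> ?L" for ys
      by (rule measurable_insort_key) (use that Cons.prems in auto)
  qed simp
  then show ?case by simp
qed simp

lemma measurable_kth_largest_index:
  assumes "\<And>i. i \<in> {1..M} \<Longrightarrow> (\<lambda>\<omega>. e i \<omega>) \<in> borel_measurable N"
  shows "(\<lambda>\<omega>. kth_largest_index k M (\<lambda>i. e i \<omega>)) \<in> measurable N (count_space UNIV)"
  unfolding kth_largest_index_def
  by (rule measurable_compose[OF measurable_sort_key]) (use assms in auto)

lemma kth_largest_index_in:
  assumes "1 \<le> k" "k \<le> M"
  shows "kth_largest_index k M e \<in> {1..M}"
proof -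
  have "kth_largest_index k M e \<in> set (sort_key (\<lambda>i. - e i) [1..<Suc M])"
    unfolding kth_largest_index_def by (rule nth_mem) (use assms in simp)
  then show ?thesis by auto
qed

text \<open>In a list sorted by \<open>- e\<close>, every index with strictly larger
  \<open>e\<close> stands before position \<open>k - 1\<close>, counted from 0. The strict
  comparison makes the tie-breaking rule irrelevant.\<close>

lemma card_greater_kth_largest:
  assumes "1 \<le> k" "k \<le> M"
  shows "card {i \<in> {1..M}. e (kth_largest_index k M e) < e i} < k"
proof -
  define l where "l = sort_key (\<lambda>i. - e i) [1..<Suc M]"
  have l: "set l = {1..M}" "length l = M" "sorted (map (\<lambda>i. - e i) l)"
    by (auto simp: l_def simp del: upt_Suc)
  have "{i \<in> {1..M}. e (l ! (k - 1)) < e i} \<subseteq> set (take (k - 1) l)"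
  proof safe
    fix i assume "i \<in> {1..M}" and less: "e (l ! (k - 1)) < e i"
    then obtain j where j: "j < M" "i = l ! j"
      using l by (metis in_set_conv_nth)
    have "j < k - 1"
    proof (rule ccontr)
      assume "\<not> j < k - 1"
      then have "- e (l ! (k - 1)) \<le> - e (l ! j)"
        using sorted_nth_mono[OF l(3), of "k - 1" j] j l(2) by simp
      with less j show False by simp
    qed
    with j l(2) show "i \<in> set (take (k - 1) l)"
      by (auto simp: in_set_conv_nth intro!: exI[of _ j])
  qed
  then have "card {i \<in> {1..M}. e (l ! (k - 1)) < e i} \<le> card (set (take (k - 1) l))"
    by (intro card_mono) auto
  also have "\<dots> \<le> k - 1"
    using card_length[of "take (k - 1) l"] by simp
  finally show ?thesis
    using assms by (simp add: kth_largest_index_def l_def)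
qed

section \<open>Independent selection and the scarcity of large gains\<close>

text \<open>Splitting by the value of \<open>T\<close>, independence gives the sum of
  \<open>prob (T = i) * q\<close>, and the probabilities of \<open>T = i\<close> add up to 1.
  \<open>T\<close> is cast to \<open>real\<close> because \<open>indep_var\<close> wants both
  variables of one value type.\<close>

lemma (in prob_space) prob_indep_selection:
  fixes T :: "'a \<Rightarrow> nat" and H :: "nat \<Rightarrow> 'a \<Rightarrow> real"
  assumes "finite I" and T: "\<And>\<omega>. \<omega> \<in> space M \<Longrightarrow> T \<omega> \<in> I"
    and indep: "\<And>i. i \<in> I \<Longrightarrow> indep_var borel (\<lambda>\<omega>. real (T \<omega>)) borel (H i)"
    and H: "\<And>i. i \<in> I \<Longrightarrow> \<P>(\<omega> in M. H i \<omega> \<le> s) = q"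
  shows "{\<omega> \<in> space M. H (T \<omega>) \<omega> \<le> s} \<in> events"
    and "\<P>(\<omega> in M. H (T \<omega>) \<omega> \<le> s) = q"
proof -
  define B where "B i = {\<omega> \<in> space M. T \<omega> = i}" for i
  define A where "A i = {\<omega> \<in> space M. T \<omega> = i \<and> H i \<omega> \<le> s}" for i
  have meas: "(\<lambda>\<omega>. real (T \<omega>)) \<in> borel_measurable M" "H i \<in> borel_measurable M" if "i \<in> I" for i
    using indep_var_rv1[OF indep[OF that]] indep_var_rv2[OF indep[OF that]] by simp_all
  have A: "A i \<in> events" and B: "B i \<in> events" if "i \<in> I" for i
  proof -
    note [measurable] = meas[OF that]
    have "{\<omega> \<in> space M. real (T \<omega>) = real i \<and> H i \<omega> \<le> s} \<in> events"
      "{\<omega> \<in> space M. real (T \<omega>) = real i} \<in> events" by measurable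
    then show "A i \<in> events" "B i \<in> events" by (simp_all add: A_def B_def)
  qed
  have prob_A: "prob (A i) = prob (B i) * q" if "i \<in> I" for i
  proof -
    have "A i = (\<lambda>\<omega>. (real (T \<omega>), H i \<omega>)) -` ({real i} \<times> {..s}) \<inter> space M"
      "B i = (\<lambda>\<omega>. real (T \<omega>)) -` {real i} \<inter> space M" "{\<omega> \<in> space M. H i \<omega> \<le> s} = H i -` {..s} \<inter> space M"
      by (auto simp: A_def B_def)
    then show ?thesis
      using indep_varD[OF indep[OF that], of "{real i}" "{..s}"] H[OF that] by simp
  qed
  have eq: "{\<omega> \<in> space M. H (T \<omega>) \<omega> \<le> s} = (\<Union>i\<in>I. A i)"
    using T by (auto simp: A_def)
  show "{\<omega> \<in> space M. H (T \<omega>) \<omega> \<le> s} \<in> events"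
    unfolding eq using A \<open>finite I\<close> by auto
  have "\<P>(\<omega> in M. H (T \<omega>) \<omega> \<le> s) = (\<Sum>i\<in>I. prob (A i))"
    unfolding eq using A \<open>finite I\<close>
    by (intro finite_measure_finite_Union) (auto simp: A_def disjoint_family_on_def)
  also have "\<dots> = (\<Sum>i\<in>I. prob (B i)) * q"
    by (simp add: prob_A sum_distrib_right)
  also have "(\<Sum>i\<in>I. prob (B i)) = prob (\<Union>i\<in>I. B i)"
    using B \<open>finite I\<close>
    by (intro finite_measure_finite_Union[symmetric]) (auto simp: B_def disjoint_family_on_def)
  also have "(\<Union>i\<in>I. B i) = space M"
    using T by (auto simp: B_def)
  finally show "\<P>(\<omega> in M. H (T \<omega>) \<omega> \<le> s) = q"
    by (simp add: prob_space)
qed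

text \<open>Split \<open>{1..N}\<close> into \<open>k\<close> blocks of length \<open>N div k\<close>: if fewer than \<open>k\<close> of the
  variables reach \<open>L\<close>, then some block contains none of them.\<close>

lemma (in prob_space) prob_few_large_le:
  fixes G :: "nat \<Rightarrow> 'a \<Rightarrow> real"
  assumes indep: "indep_vars (\<lambda>_. borel) G {1..}"
    and q: "\<And>i. i \<ge> 1 \<Longrightarrow> \<P>(\<omega> in M. G i \<omega> < L) = q"
  shows "\<P>(\<omega> in M. card {i \<in> {1..N}. L \<le> G i \<omega>} < k) \<le> real k * q ^ (N div k)"
proof -
  define n where "n = N div k"
  define B where "B j = {j * n<..Suc j * n}" for j
  define A where "A j = {\<omega> \<in> space M. \<forall>i\<in>B j. G i \<omega> < L}" for j
  have meas: "G i \<in> borel_measurable M" if "i \<ge> 1" for i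
    using indep that by (auto simp: indep_vars_def)
  have B_ge: "i \<ge> 1" if "i \<in> B j" for i j
    using that by (auto simp: B_def)
  \<comment> \<open>An intersection over an empty block would not be the whole space, so
    \<open>n = 0\<close> is kept apart; there \<open>A j\<close> is the space and
    \<open>q ^ 0 = 1\<close>.\<close>
  have A_eq: "A j = (\<Inter>i\<in>B j. G i -` {..<L} \<inter> space M)" if "n > 0" for j
  proof -
    have "B j \<noteq> {}" using that by (simp add: B_def)
    then show ?thesis by (auto simp: A_def)
  qed
  have A: "A j \<in> events" for j
  proof (cases "n > 0")
    case True
    have "B j \<noteq> {}" using True by (simp add: B_def)
    moreover have "G i -` {..<L} \<inter> space M \<in> events" if "i \<in> B j" for i
      using meas[OF B_ge[OF that]] by (rule measurable_sets) simp
    ultimately show ?thesis unfolding A_eq[OF True]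
      by (intro sets.finite_INT) (auto simp: B_def)
  next
    case False
    then show ?thesis by (simp add: A_def B_def)
  qed
  have prob_A: "prob (A j) = q ^ n" for j
  proof (cases "n > 0")
    case True
    have "B j \<noteq> {}" using True by (simp add: B_def)
    have "prob (A j) = (\<Prod>i\<in>B j. prob (G i -` {..<L} \<inter> space M))"
      unfolding A_eq[OF True] using \<open>B j \<noteq> {}\<close> B_ge
      by (intro indep_varsD[OF indep]) (auto simp: B_def)
    also have "\<dots> = (\<Prod>i\<in>B j. q)"
    proof (rule prod.cong)
      fix i assume "i \<in> B j"
      moreover have "G i -` {..<L} \<inter> space M = {\<omega> \<in> space M. G i \<omega> < L}" by auto
      ultimately show "prob (G i -` {..<L} \<inter> space M) = q"
        using q[OF B_ge] by simp
    qed simp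
    also have "\<dots> = q ^ n" by (simp add: B_def)
    finally show ?thesis .
  next
    case False
    then show ?thesis by (simp add: A_def B_def prob_space)
  qed
  have "{\<omega> \<in> space M. card {i \<in> {1..N}. L \<le> G i \<omega>} < k} \<subseteq> (\<Union>j<k. A j)"
  proof (rule subsetI, rule ccontr)
    fix \<omega> assume \<omega>: "\<omega> \<in> {\<omega> \<in> space M. card {i \<in> {1..N}. L \<le> G i \<omega>} < k}"
      and "\<omega> \<notin> (\<Union>j<k. A j)"
    then have "\<forall>j<k. \<exists>i\<in>B j. L \<le> G i \<omega>"
      by (auto simp: A_def not_less)
    then obtain c where c: "\<And>j. j < k \<Longrightarrow> c j \<in> B j \<and> L \<le> G (c j) \<omega>"
      by metis
    \<comment> \<open>Block \<open>j\<close> is \<open>j * n + 1, ..., (j + 1) * n\<close>; after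
      subtracting 1, division by \<open>n\<close> recovers \<open>j\<close>. Hence witnesses from
      different blocks are distinct.\<close>
    have "(c j - 1) div n = j" if "j < k" for j
      using c[OF that] by (intro div_nat_eqI) (auto simp: B_def mult.commute)
    then have "inj_on c {..<k}"
      by (intro inj_on_inverseI[where g = "\<lambda>i. (i - 1) div n"]) simp
    moreover have "c ` {..<k} \<subseteq> {i \<in> {1..N}. L \<le> G i \<omega>}"
    proof safe
      fix j assume "j < k"
      have "Suc j * n \<le> k * n" using \<open>j < k\<close> by (intro mult_right_mono) auto
      also have "\<dots> \<le> N" by (simp add: n_def)
      finally show "c j \<in> {1..N}" using c[OF \<open>j < k\<close>] by (auto simp: B_def)
    qed (use c in auto)
    ultimately have "k \<le> card {i \<in> {1..N}. L \<le> G i \<omega>}"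
      using card_mono[of "{i \<in> {1..N}. L \<le> G i \<omega>}" "c ` {..<k}"] by (simp add: card_image)
    with \<omega> show False by simp
  qed
  then have "\<P>(\<omega> in M. card {i \<in> {1..N}. L \<le> G i \<omega>} < k) \<le> prob (\<Union>j<k. A j)"
    using A by (intro finite_measure_mono) auto
  also have "\<dots> \<le> (\<Sum>j<k. prob (A j))"
    using A by (intro finite_measure_subadditive_finite) auto
  also have "\<dots> = real k * q ^ (N div k)"
    by (simp add: prob_A n_def)
  finally show ?thesis .
qed

text \<open>Injectivity makes the singletons \<open>{f j}\<close> disjoint, so grouping the family
  along them preserves independence. With \<open>f = Inl\<close> this extracts the gains
  \<open>g\<close> from the joint family.\<close>

lemma (in prob_space) indep_vars_reindex:
  assumes "indep_vars (\<lambda>_. N) X I" and "inj_on f L" "f ` L \<subseteq> I"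
  shows "indep_vars (\<lambda>_. N) (\<lambda>j. X (f j)) L"
proof -
  have "indep_vars (\<lambda>j. PiM {f j} (\<lambda>_. N)) (\<lambda>j \<omega>. restrict (\<lambda>i. X i \<omega>) {f j}) L"
    using assms by (intro indep_vars_restrict) (auto simp: disjoint_family_on_def inj_on_def)
  then have "indep_vars (\<lambda>_. N) (\<lambda>j \<omega>. (restrict (\<lambda>i. X i \<omega>) {f j}) (f j)) L"
    by (rule indep_vars_compose2) simp
  then show ?thesis by simp
qed

lemma insort_key_cong:
  "(\<And>y. y \<in> insert x (set ys) \<Longrightarrow> f y = g y) \<Longrightarrow> insort_key f x ys = insort_key g x ys"
  by (induction ys) auto

lemma sort_key_cong:
  "(\<And>x. x \<in> set xs \<Longrightarrow> f x = g x) \<Longrightarrow> sort_key f xs = sort_key g xs"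
  by (induction xs) (auto intro!: insort_key_cong)

text \<open>This allows the selected index to be computed from the family restricted to the first
  \<open>M\<close> gains, as its independence from the \<open>h\<close> gains requires.\<close>

lemma kth_largest_index_cong:
  assumes "\<And>i. i \<in> {1..M} \<Longrightarrow> e i = e' i"
  shows "kth_largest_index k M e = kth_largest_index k M e'"
  unfolding kth_largest_index_def
  by (rule arg_cong[where f = "\<lambda>l. l ! _"], rule sort_key_cong) (use assms in auto)

section \<open>Harvested energy and SNR as functions of the gains\<close>

text \<open>Over a common denominator the energy is a constant multiple of the saturating map
  \<open>u / (u + c)\<close> at \<open>u = Pt * G\<close>; monotonicity and the SNR threshold are
  read off from this form.\<close>

lemma harvested_energy_eq:
  assumes "Pt > 0" "c > 0" "G \<ge> 0"
  shows "harvested_energy t1 Pt a b c G = t1 * (a * c - b) / c * (Pt * G / (Pt * G + c))"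
proof -
  have "Pt * G + c > 0" using assms by (simp add: add_nonneg_pos)
  then show ?thesis using \<open>c > 0\<close> by (simp add: harvested_energy_def divide_simps) algebra
qed

lemma harvested_energy_strict_mono:
  assumes "Pt > 0" "c > 0" "t1 > 0" "a * c - b > 0" "0 \<le> G" "G < G'"
  shows "harvested_energy t1 Pt a b c G < harvested_energy t1 Pt a b c G'"
proof -
  have "Pt * G + c > 0" "Pt * G' + c > 0" using assms by (simp_all add: add_nonneg_pos)
  then have "Pt * G / (Pt * G + c) < Pt * G' / (Pt * G' + c)"
    using assms by (simp add: frac_less_eq divide_simps algebra_simps)
  then have "t1 * (a * c - b) / c * (Pt * G / (Pt * G + c)) < t1 * (a * c - b) / c * (Pt * G' / (Pt * G' + c))"
    using assms by (intro mult_strict_left_mono) auto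
  then show ?thesis
    using assms by (subst (1 2) harvested_energy_eq) auto
qed

text \<open>The SNR is linear in \<open>H\<close> with slope \<open>q\<close>, and
  \<open>G > 0\<close> makes \<open>q\<close> positive, so the threshold for \<open>H\<close> is
  \<open>x / q\<close>.\<close>

lemma snr_le_iff:
  assumes "Pt > 0" "\<sigma>2 > 0" "t1 > 0" "t2 > 0" "c > 0" "a * c - b > 0" "G > 0"
  shows "snr t2 \<sigma>2 H (harvested_energy t1 Pt a b c G) \<le> x
    \<longleftrightarrow> H \<le> \<sigma>2 * c * t2 * x / (t1 * (a * c - b)) * (1 + c / (Pt * G))"
proof -
  define d where "d = a * c - b"
  have "Pt * G + c > 0" using assms by (simp add: add_pos_pos)
  define q where "q = t1 * d * (Pt * G) / (t2 * \<sigma>2 * c * (Pt * G + c))"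
  have "d > 0" using assms by (simp add: d_def)
  have "q > 0"
    using assms \<open>d > 0\<close> \<open>Pt * G + c > 0\<close> by (simp add: q_def)
  have "snr t2 \<sigma>2 H (harvested_energy t1 Pt a b c G) = H * q"
    using assms \<open>Pt * G + c > 0\<close> by (simp add: snr_def harvested_energy_eq q_def d_def)
  moreover have "x / q = \<sigma>2 * c * t2 * x / (t1 * d) * (1 + c / (Pt * G))"
    using assms \<open>d > 0\<close> \<open>Pt * G + c > 0\<close> by (simp add: q_def field_simps)
  ultimately show ?thesis
    using pos_le_divide_eq[OF \<open>q > 0\<close>, of H x] by (simp add: d_def)
qed

section \<open>Two-sided bounds on the outage probability\<close>

text \<open>The threshold \<open>r * (1 + c / (Pt * G))\<close> for the selected \<open>H\<close>
  always exceeds \<open>r\<close>, which gives the lower bound. It is at most its value at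
  \<open>L\<close> unless the selected gain is below \<open>L\<close>, and then fewer than
  \<open>k\<close> gains reach \<open>L\<close>.\<close>

lemma ebs_outage_bounds:
  fixes \<Omega> :: "'w measure"
    and g h :: "nat \<Rightarrow> 'w \<Rightarrow> complex"
  assumes "prob_space \<Omega>"
    and indep: "prob_space.indep_vars \<Omega> (\<lambda>_. borel)
           (case_sum (\<lambda>i \<omega>. (cmod (g i \<omega>))\<^sup>2) (\<lambda>i \<omega>. (cmod (h i \<omega>))\<^sup>2)) ({1..} <+> {1..})"
    and g: "\<And>i. i \<ge> 1 \<Longrightarrow> distributed \<Omega> lborel (\<lambda>\<omega>. (cmod (g i \<omega>))\<^sup>2) (exponential_density 1)"
    and h: "\<And>i. i \<ge> 1 \<Longrightarrow> distributed \<Omega> lborel (\<lambda>\<omega>. (cmod (h i \<omega>))\<^sup>2) (exponential_density 1)"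
    and pos: "Pt > 0" "\<sigma>2 > 0" "t1 > 0" "t2 > 0" "c > 0" "a * c - b > 0" "x > 0"
    and r: "r = \<sigma>2 * c * t2 * x / (t1 * (a * c - b))"
    and "1 \<le> k" "k \<le> M" "L > 0"
  shows "1 - exp (- r) \<le> ebs_outage \<Omega> g h Pt \<sigma>2 t1 t2 a b c k M x"
    and "ebs_outage \<Omega> g h Pt \<sigma>2 t1 t2 a b c k M x
      \<le> 1 - exp (- (r * (1 + c / (Pt * L)))) + real k * (1 - exp (- L)) ^ (M div k)"
proof -
  interpret prob_space \<Omega> by fact
  define G where "G i \<omega> = (cmod (g i \<omega>))\<^sup>2" for i \<omega>
  define H where "H i \<omega> = (cmod (h i \<omega>))\<^sup>2" for i \<omega>
  let ?harv = "harvested_energy t1 Pt a b c"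
  define T where "T \<omega> = kth_largest_index k M (\<lambda>i. ?harv (G i \<omega>))" for \<omega>
  define Fail where "Fail = {\<omega> \<in> space \<Omega>. snr t2 \<sigma>2 (H (T \<omega>) \<omega>) (?harv (G (T \<omega>) \<omega>)) \<le> x}"
  have outage: "ebs_outage \<Omega> g h Pt \<sigma>2 t1 t2 a b c k M x = prob Fail"
    by (simp add: ebs_outage_def Fail_def T_def G_def H_def Let_def)
  have "r > 0" using pos by (simp add: r)
  have T_in: "T \<omega> \<in> {1..M}" for \<omega>
    unfolding T_def by (rule kth_largest_index_in) fact+
  have G_nonneg: "G i \<omega> \<ge> 0" for i \<omega> by (simp add: G_def)
  have G_dist: "distributed \<Omega> lborel (G i) (exponential_density 1)"
    and H_dist: "distributed \<Omega> lborel (H i) (exponential_density 1)" if "i \<ge> 1" for i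
    using g[OF that] h[OF that] by (simp_all add: G_def[abs_def] H_def[abs_def])
  have meas: "G i \<in> borel_measurable \<Omega>" "H i \<in> borel_measurable \<Omega>" if "i \<ge> 1" for i
    using distributed_measurable[OF G_dist[OF that]] distributed_measurable[OF H_dist[OF that]]
    by simp_all
  have harv_meas [measurable]: "?harv \<in> borel_measurable borel"
    unfolding harvested_energy_def[abs_def] by measurable
  have T_meas [measurable]: "T \<in> measurable \<Omega> (count_space UNIV)"
    unfolding T_def[abs_def]
    by (intro measurable_kth_largest_index measurable_compose[OF meas(1) harv_meas]) auto
  have indep': "indep_vars (\<lambda>_. borel) (case_sum G H) ({1..} <+> {1..})"
    using indep by (simp add: G_def[abs_def] H_def[abs_def])

  \<comment> \<open>\<open>T\<close> depends only on the coordinates \<open>Inl i\<close> with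
    \<open>i \<le> M\<close>, and \<open>H j\<close> is the coordinate \<open>Inr j\<close>; these
    index sets are disjoint.\<close>
  have TH: "indep_var borel (\<lambda>\<omega>. real (T \<omega>)) borel (H j)" if "j \<in> {1..M}" for j
  proof -
    let ?A = "Inl ` {1..M} :: (nat + nat) set"
    let ?Y = "\<lambda>v. real (kth_largest_index k M (\<lambda>i. ?harv (v (Inl i))))"
    have "indep_var (PiM ?A (\<lambda>_. borel)) (\<lambda>\<omega>. restrict (\<lambda>i. case_sum G H i \<omega>) ?A)
        (PiM {Inr j} (\<lambda>_. borel)) (\<lambda>\<omega>. restrict (\<lambda>i. case_sum G H i \<omega>) {Inr j})"
      using that by (intro indep_var_restrict[OF indep']) auto
    then have "indep_var borel (?Y \<circ> (\<lambda>\<omega>. restrict (\<lambda>i. case_sum G H i \<omega>) ?A))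
        borel ((\<lambda>w. w (Inr j)) \<circ> (\<lambda>\<omega>. restrict (\<lambda>i. case_sum G H i \<omega>) {Inr j}))"
    proof (rule indep_var_compose)
      have "(\<lambda>v. ?harv (v (Inl i))) \<in> borel_measurable (PiM ?A (\<lambda>_. borel))" if "i \<in> {1..M}" for i
      proof -
        have "(\<lambda>v. v (Inl i)) \<in> borel_measurable (PiM ?A (\<lambda>_. borel :: real measure))"
          by (rule measurable_component_singleton) (use that in simp)
        then show ?thesis by (rule measurable_compose[OF _ harv_meas])
      qed
      then show "?Y \<in> borel_measurable (PiM ?A (\<lambda>_. borel))"
        by (intro measurable_compose[OF measurable_kth_largest_index]) auto
    qed simp
    moreover have "?Y \<circ> (\<lambda>\<omega>. restrict (\<lambda>i. case_sum G H i \<omega>) ?A) = (\<lambda>\<omega>. real (T \<omega>))"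
      by (auto simp: fun_eq_iff T_def intro!: kth_largest_index_cong)
    ultimately show ?thesis by (simp add: o_def)
  qed
  have H_sel: "{\<omega> \<in> space \<Omega>. H (T \<omega>) \<omega> \<le> s} \<in> events"
    "\<P>(\<omega> in \<Omega>. H (T \<omega>) \<omega> \<le> s) = 1 - exp (- s)" if "s \<ge> 0" for s
    using prob_indep_selection[of "{1..M}" T H s "1 - exp (- s)"] T_in TH that
      exponential_distributedD_le[OF H_dist that] by auto

  \<comment> \<open>With the random index frozen to \<open>i\<close>, each piece is visibly
    measurable.\<close>
  have "Fail = (\<Union>i\<in>{1..M}. {\<omega> \<in> space \<Omega>. T \<omega> = i \<and> snr t2 \<sigma>2 (H i \<omega>) (?harv (G i \<omega>)) \<le> x})"
    using T_in by (auto simp: Fail_def)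
  moreover have "{\<omega> \<in> space \<Omega>. T \<omega> = i \<and> snr t2 \<sigma>2 (H i \<omega>) (?harv (G i \<omega>)) \<le> x} \<in> events"
    if "i \<in> {1..M}" for i
  proof -
    have [measurable]: "G i \<in> borel_measurable \<Omega>" "H i \<in> borel_measurable \<Omega>"
      using meas that by auto
    show ?thesis unfolding snr_def by measurable
  qed
  ultimately have Fail_events: "Fail \<in> events" by auto

  have "{\<omega> \<in> space \<Omega>. H (T \<omega>) \<omega> \<le> r} \<subseteq> Fail"
  proof safe
    fix \<omega> assume \<omega>: "\<omega> \<in> space \<Omega>" "H (T \<omega>) \<omega> \<le> r"
    show "\<omega> \<in> Fail"
    \<comment> \<open>The inclusion is pointwise, so zero gain needs its own argument: the energy
      and the SNR vanish, and \<open>0 \<le> x\<close>.\<close>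
    proof (cases "G (T \<omega>) \<omega> = 0")
      case True
      then show ?thesis using \<omega> pos by (simp add: Fail_def snr_def harvested_energy_eq)
    next
      case False
      then have "G (T \<omega>) \<omega> > 0" using G_nonneg[of "T \<omega>" \<omega>] by simp
      moreover from this have "r \<le> r * (1 + c / (Pt * G (T \<omega>) \<omega>))"
        using \<open>r > 0\<close> pos by simp
      ultimately show ?thesis
        using \<omega> pos snr_le_iff[of Pt \<sigma>2 t1 t2 c a b "G (T \<omega>) \<omega>"] by (simp add: Fail_def r)
    qed
  qed
  then show "1 - exp (- r) \<le> ebs_outage \<Omega> g h Pt \<sigma>2 t1 t2 a b c k M x"
    using finite_measure_mono[of "{\<omega> \<in> space \<Omega>. H (T \<omega>) \<omega> \<le> r}" Fail] Fail_events
      H_sel(2)[of r] \<open>r > 0\<close> by (simp add: outage)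

  define s where "s = r * (1 + c / (Pt * L))"
  have "s \<ge> 0" using \<open>r > 0\<close> \<open>L > 0\<close> pos by (simp add: s_def)
  let ?F = "{\<omega> \<in> space \<Omega>. card {i \<in> {1..M}. L \<le> G i \<omega>} < k}"
  have F_events: "?F \<in> events"
  proof -
    have *: "(\<lambda>\<omega>. \<Sum>i\<in>{1..M}. indicator {L..} (G i \<omega>) :: real) \<in> borel_measurable \<Omega>"
      by (intro borel_measurable_sum measurable_compose[OF meas(1)]) auto
    \<comment> \<open>Writing the count as a sum of indicators exhibits it as a measurable
      function.\<close>
    have "(\<Sum>i\<in>{1..M}. indicator {L..} (G i \<omega>) :: real) = real (card {i \<in> {1..M}. L \<le> G i \<omega>})" for \<omega>
      by (simp add: indicator_def sum.If_cases Int_def)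
    then have "?F = {\<omega> \<in> space \<Omega>. (\<Sum>i\<in>{1..M}. indicator {L..} (G i \<omega>) :: real) < real k}"
      by simp
    also have "\<dots> \<in> events" using * by measurable
    finally show ?thesis .
  qed
  have "Fail \<subseteq> {\<omega> \<in> space \<Omega>. H (T \<omega>) \<omega> \<le> s} \<union> ?F"
  proof
    fix \<omega> assume "\<omega> \<in> Fail"
    then have \<omega>: "\<omega> \<in> space \<Omega>" "snr t2 \<sigma>2 (H (T \<omega>) \<omega>) (?harv (G (T \<omega>) \<omega>)) \<le> x"
      by (auto simp: Fail_def)
    show "\<omega> \<in> {\<omega> \<in> space \<Omega>. H (T \<omega>) \<omega> \<le> s} \<union> ?F"
    proof (cases "G (T \<omega>) \<omega> < L")
      case True
      \<comment> \<open>Every device whose gain reaches \<open>L\<close> harvests strictly more than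
        the selected one, and fewer than \<open>k\<close> devices do so.\<close>
      then have "{i \<in> {1..M}. L \<le> G i \<omega>} \<subseteq> {i \<in> {1..M}. ?harv (G (T \<omega>) \<omega>) < ?harv (G i \<omega>)}"
        using pos G_nonneg by (auto intro!: harvested_energy_strict_mono)
      then have "card {i \<in> {1..M}. L \<le> G i \<omega>} \<le> card {i \<in> {1..M}. ?harv (G (T \<omega>) \<omega>) < ?harv (G i \<omega>)}"
        by (intro card_mono) auto
      also have "\<dots> < k"
        unfolding T_def by (rule card_greater_kth_largest) fact+
      finally show ?thesis using \<omega> by simp
    next
      case False
      then have "G (T \<omega>) \<omega> > 0" using \<open>L > 0\<close> by simp
      then have "H (T \<omega>) \<omega> \<le> r * (1 + c / (Pt * G (T \<omega>) \<omega>))"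
        using \<omega>(2) pos by (simp add: snr_le_iff r)
      also have "\<dots> \<le> s"
        unfolding s_def using False \<open>L > 0\<close> \<open>r > 0\<close> pos
        by (intro mult_left_mono add_left_mono divide_left_mono) auto
      finally show ?thesis using \<omega> by simp
    qed
  qed
  then have "prob Fail \<le> prob ({\<omega> \<in> space \<Omega>. H (T \<omega>) \<omega> \<le> s} \<union> ?F)"
    by (rule finite_measure_mono) (intro sets.Un H_sel(1)[OF \<open>s \<ge> 0\<close>] F_events)
  also have "\<dots> \<le> \<P>(\<omega> in \<Omega>. H (T \<omega>) \<omega> \<le> s) + prob ?F"
    by (rule measure_Un_le[OF H_sel(1)[OF \<open>s \<ge> 0\<close>] F_events])
  also have "prob ?F \<le> real k * (1 - exp (- L)) ^ (M div k)"
  proof (rule prob_few_large_le)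
    show "indep_vars (\<lambda>_. borel) G {1..}"
      using indep_vars_reindex[OF indep', of Inl "{1..}"] by auto
    show "\<P>(\<omega> in \<Omega>. G i \<omega> < L) = 1 - exp (- L)" if "i \<ge> 1" for i
    proof -
      have [measurable]: "G i \<in> borel_measurable \<Omega>" using meas that by simp
      \<comment> \<open>The gain has a density, so the value \<open>L\<close> has probability zero
        and the exponential distribution function applies.\<close>
      have "\<P>(\<omega> in \<Omega>. G i \<omega> < L) = \<P>(\<omega> in \<Omega>. G i \<omega> \<le> L)"
      proof (rule measure_eq_AE)
        have "AE y in lborel. 0 < exponential_density 1 y \<longrightarrow> y \<noteq> L"
          using AE_lborel_singleton[of L] by eventually_elim simp
        then have "AE \<omega> in \<Omega>. G i \<omega> \<noteq> L"
          using distributed_AE2[OF G_dist[OF that], of "\<lambda>y. y \<noteq> L"] by simp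
        then show "AE \<omega> in \<Omega>. (\<omega> \<in> {\<omega> \<in> space \<Omega>. G i \<omega> < L}) \<longleftrightarrow> (\<omega> \<in> {\<omega> \<in> space \<Omega>. G i \<omega> \<le> L})"
          by eventually_elim auto
      qed measurable
      then show ?thesis
        using exponential_distributedD_le[OF G_dist[OF that], of L] \<open>L > 0\<close> by simp
    qed
  qed
  finally show "ebs_outage \<Omega> g h Pt \<sigma>2 t1 t2 a b c k M x
      \<le> 1 - exp (- (r * (1 + c / (Pt * L)))) + real k * (1 - exp (- L)) ^ (M div k)"
    using H_sel(2)[OF \<open>s \<ge> 0\<close>] by (simp add: outage s_def)
qed

section \<open>Convergence of the outage probability and conclusion\<close>

theorem proposition2:
  fixes \<Omega> :: "'w measure"
    and g h :: "nat \<Rightarrow> 'w \<Rightarrow> complex"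
    and Pt \<sigma>2 t1 t2 a b c r x :: real
    and k :: nat
  assumes "prob_space \<Omega>"
    and "prob_space.indep_vars \<Omega> (\<lambda>_. borel)
           (case_sum (\<lambda>i \<omega>. (cmod (g i \<omega>))\<^sup>2) (\<lambda>i \<omega>. (cmod (h i \<omega>))\<^sup>2)) ({1..} <+> {1..})"
    and "\<And>i. i \<ge> 1 \<Longrightarrow> distributed \<Omega> lborel (\<lambda>\<omega>. (cmod (g i \<omega>))\<^sup>2) (exponential_density 1)"
    and "\<And>i. i \<ge> 1 \<Longrightarrow> distributed \<Omega> lborel (\<lambda>\<omega>. (cmod (h i \<omega>))\<^sup>2) (exponential_density 1)"
    and "Pt > 0" and "\<sigma>2 > 0"
    and "0 < t1" and "t1 < 1" and "t2 = 1 - t1"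
    and "c > 0" and "a * c - b > 0"
    and "k \<ge> 1" and "x > 0"
    and "r = \<sigma>2 * c * t2 * x / (t1 * (a * c - b))"
  shows "(\<lambda>M. ebs_outage \<Omega> g h Pt \<sigma>2 t1 t2 a b c k M x - ebs_outage_asymp Pt c r k M)
           \<longlonglongrightarrow> 0"
proof -
  have "t2 > 0" using assms(8,9) by simp
  have "r > 0" using assms(6,7,10,11,13) \<open>t2 > 0\<close> by (simp add: assms(14))
  let ?\<Pi> = "\<lambda>M. ebs_outage \<Omega> g h Pt \<sigma>2 t1 t2 a b c k M x"
  note bounds = ebs_outage_bounds[OF assms(1,2) _ _ assms(5-7) \<open>t2 > 0\<close> assms(10,11,13,14) \<open>k \<ge> 1\<close>]
  have lower: "1 - exp (- r) \<le> ?\<Pi> M" if "M \<ge> k" for M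
    by (rule bounds(1)[OF _ _ that zero_less_one]) (use assms(3,4) in auto)
  have upper: "?\<Pi> M \<le> 1 - exp (- (r * (1 + c / (Pt * L)))) + real k * (1 - exp (- L)) ^ (M div k)"
    if "M \<ge> k" "L > 0" for M L
    by (rule bounds(2)[OF _ _ that]) (use assms(3,4) in auto)
  have "?\<Pi> \<longlonglongrightarrow> 1 - exp (- r)"
  proof (rule order_tendstoI)
    fix y assume "y < 1 - exp (- r)"
    then have "y < ?\<Pi> M" if "M \<ge> k" for M
      using lower[OF that] by simp
    then show "\<forall>\<^sub>F M in sequentially. y < ?\<Pi> M"
      by (rule eventually_mono[OF eventually_ge_at_top[of k]])
  next
    fix y assume y: "1 - exp (- r) < y"
    have "((\<lambda>L. 1 - exp (- (r * (1 + c / (Pt * L))))) \<longlongrightarrow> 1 - exp (- (r * (1 + 0)))) at_top"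
      using \<open>Pt > 0\<close>
      by (intro tendsto_intros tendsto_divide_0[OF tendsto_const] filterlim_at_top_imp_at_infinity
          filterlim_tendsto_pos_mult_at_top[OF tendsto_const] filterlim_ident)
    then have "\<forall>\<^sub>F L in at_top. 1 - exp (- (r * (1 + c / (Pt * L)))) < y"
      by (rule order_tendstoD(2)) (use y in simp)
    then have "\<forall>\<^sub>F L in at_top. L > 0 \<and> 1 - exp (- (r * (1 + c / (Pt * L)))) < y"
      using eventually_gt_at_top[of "0::real"] by eventually_elim simp
    \<comment> \<open>\<open>L\<close> is fixed before \<open>M\<close> grows: it brings the first
      part of the upper bound below \<open>y\<close>, and for this fixed \<open>L\<close> the
      remaining power then tends to 0.\<close>
    then obtain L where L: "L > 0" "1 - exp (- (r * (1 + c / (Pt * L)))) < y"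
      by (auto dest: eventually_happens)
    \<comment> \<open>The block length grows without bound because \<open>k \<ge> 1\<close> is
      fixed.\<close>
    have "filterlim (\<lambda>M. M div k) at_top sequentially"
      unfolding filterlim_at_top
    proof
      fix Z
      have "Z \<le> M div k" if "M \<ge> Z * k" for M
        using that \<open>k \<ge> 1\<close> by (simp add: less_eq_div_iff_mult_less_eq)
      then show "\<forall>\<^sub>F M in sequentially. Z \<le> M div k"
        by (rule eventually_mono[OF eventually_ge_at_top[of "Z * k"]])
    qed
    moreover have "(\<lambda>n. (1 - exp (- L)) ^ n) \<longlonglongrightarrow> 0"
      using L(1) by (intro LIMSEQ_realpow_zero) auto
    ultimately have "(\<lambda>M. (1 - exp (- L)) ^ (M div k)) \<longlonglongrightarrow> 0"
      by (rule filterlim_compose[rotated])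
    then have "(\<lambda>M. 1 - exp (- (r * (1 + c / (Pt * L)))) + real k * (1 - exp (- L)) ^ (M div k))
        \<longlonglongrightarrow> 1 - exp (- (r * (1 + c / (Pt * L)))) + real k * 0"
      by (intro tendsto_intros)
    then have "\<forall>\<^sub>F M in sequentially.
        1 - exp (- (r * (1 + c / (Pt * L)))) + real k * (1 - exp (- L)) ^ (M div k) < y"
      by (rule order_tendstoD(2)) (use L in simp)
    then show "\<forall>\<^sub>F M in sequentially. ?\<Pi> M < y"
      using eventually_ge_at_top[of k]
    proof eventually_elim
      case (elim M)
      then show ?case using upper[OF elim(2) L(1)] by simp
    qed
  qed
  from tendsto_diff[OF this ebs_outage_asymp_tendsto[OF \<open>Pt > 0\<close> \<open>c > 0\<close> \<open>r > 0\<close> \<open>k \<ge> 1\<close>]]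
  show ?thesis by simp
qed

end
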